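(* Let $p\geq 5$ be an odd prime with $p \equiv 3 \pmod{4}$ and write $p-1=2r$ with $r>1$ odd. Set $m := \operatorname{ord}_r(2)$. Then $14$ nontrivially flanks $2p$ at distance $1$ at some $k$ (i.e., there exists $k\ge 1$ with $2p\in S_k$, $14\in S_{k-1}$ and $14\in S_{k+1}$) if and only if there exists an even integer $t_0 \ge 2$ such that $2^{t_0} \equiv -1 \pmod{r}$. In this case, for the minimal such $t_0$, we have $m = 2t_0$, the least $k \ge 0$ with $r \mid (2^{k+1}+1)$ is $k_{\min} := t_0 - 1$, and the set of all $k\ge 0$ with $r\mid(2^{k+1}+1)$ is exactly the set of $k\ge 0$ with $k \equiv t_0 - 1 \pmod{2t_0}$. Moreover, if $r$ is prime, then the condition on $r$ (existence of an even $t_0\ge 2$ with $2^{t_0}\equiv -1\pmod r$) is equivalent to $4 \mid \operatorname{ord}_r(2)$.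
   Context: For integers $k\ge 0$ and $n\ge 1$, $\sigma_k(n)=\sum_{d\mid n} d^k$ and $\phi(n)$ is Euler's totient function. For each $k\geq 0$, $S_k$ denotes the set of composite positive integers $n$ satisfying $n\cdot\sigma_k(n)\equiv 2 \pmod{\phi(n)}$. $\operatorname{ord}_r(2)$ is the multiplicative order of $2$ modulo $r$. *)

theory Defs
  imports "HOL-Number_Theory.Number_Theory"
begin

definition divisor_sigma :: "nat \<Rightarrow> nat \<Rightarrow> nat" where
  "divisor_sigma k n = (\<Sum>d | d dvd n. d ^ k)"

definition composite :: "nat \<Rightarrow> bool" where
  "composite n \<longleftrightarrow> n > 1 \<and> \<not> prime n"

definition S :: "nat \<Rightarrow> nat set" where
  "S k = {n. composite n \<and> [n * divisor_sigma k n = 2] (mod totient n)}"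

definition even_neg_one_exponent :: "nat \<Rightarrow> nat \<Rightarrow> bool" where
  "even_neg_one_exponent r t \<longleftrightarrow> even t \<and> t \<ge> 2 \<and> [2 ^ t = - 1] (mod int r)"

end

theory Submission
  imports Defs
begin

text \<open>
  For a prime p = 2r + 1 we have p = 1 modulo \<phi>(2p) = 2r, so 2p \<in> S k reduces to
  r dvd 2^(k+1) + 1. For p = 7 this says that k is even, hence 14 flanks 2p exactly when
  2^t = -1 (mod r) for the even exponent t = k + 1. If 2^t = -1 is solvable at all, the order of
  2 is 2s with 2^s = -1, and the solutions are the t = s (mod 2s), i.e. the odd multiples of s;
  if one of them is even then so is s, so s is the least even solution.
\<close>

lemma even_neg_one_exponent_iff_dvd:
  "even_neg_one_exponent r t \<longleftrightarrow> even t \<and> t \<ge> 2 \<and> r dvd 2 ^ t + 1"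
proof -
  have "[2 ^ t = - 1] (mod int r) \<longleftrightarrow> int r dvd int (2 ^ t + 1)"
    by (simp add: cong_iff_dvd_diff add.commute)
  then show ?thesis
    unfolding even_neg_one_exponent_def by (simp only: int_dvd_int_iff)
qed

text \<open>Oddness of \<open>p\<close> makes the four divisors 1, 2, \<open>p\<close> and
  \<open>2 * p\<close> distinct, so their power sum factors.\<close>

lemma divisor_sigma_double_prime:
  assumes "prime p" "odd p"
  shows "divisor_sigma k (2 * p) = (1 + 2 ^ k) * (1 + p ^ k)"
proof -
  have "{d. d dvd 2 * p} = {1, 2, p, 2 * p}"
  proof (intro Set.set_eqI iffI)
    fix d assume "d \<in> {d. d dvd 2 * p}"
    then obtain b c where "d = b * c" "b dvd 2" "c dvd p"
      by (auto elim: dvd_productE)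
    moreover from this have "b = 1 \<or> b = 2" "c = 1 \<or> c = p"
      using assms(1) two_is_prime_nat unfolding prime_nat_iff by blast+
    ultimately show "d \<in> {1, 2, p, 2 * p}" by auto
  qed auto
  moreover have "p \<noteq> 2" "p > 1" using assms prime_gt_1_nat by auto
  ultimately show ?thesis
    by (simp add: divisor_sigma_def algebra_simps power_mult_distrib)
qed

lemma double_prime_in_S_iff:
  assumes p: "prime p" "odd p" and r: "p - 1 = 2 * r"
  shows "2 * p \<in> S k \<longleftrightarrow> r dvd 2 ^ (k + 1) + 1"
proof -
  have p1: "p > 1" using p prime_gt_1_nat by auto
  have pr: "p = 1 + 2 * r" using r p1 by simp
  have "composite (2 * p)"
    unfolding composite_def using p1 by (auto dest: prime_product)
  moreover have "totient (2 * p) = 2 * r"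
    using p r by (simp add: totient_mult_coprime totient_prime)
  moreover have "[2 * p * divisor_sigma k (2 * p) = 2] (mod (2 * r))
    \<longleftrightarrow> r dvd 2 ^ (k + 1) + 1"
  proof -
    have "[p = 1] (mod (2 * r))" using cong_add_rcancel_0_nat[of "2 * r" 1 "2 * r"]
      by (simp add: pr cong_0_iff)
    then have "[2 * p * ((1 + 2 ^ k) * (1 + p ^ k)) = 2 * 1 * ((1 + 2 ^ k) * (1 + 1 ^ k))]
        (mod (2 * r))"
      by (intro cong_mult cong_add cong_pow cong_refl)
    \<comment> \<open>Replacing \<open>p\<close> by 1 turns the product into 4(1 + 2^k). This form
      splits off the summand 2, which cancels against the right-hand side; then a factor 2 cancels
      from the divisibility.\<close>
    moreover have "2 * 1 * ((1 + 2 ^ k) * (1 + 1 ^ k)) = 2 * (2 ^ (k + 1) + 1) + (2::nat)"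
      by simp
    ultimately have "[2 * p * divisor_sigma k (2 * p) = 2] (mod (2 * r))
        \<longleftrightarrow> [2 * (2 ^ (k + 1) + 1) + 2 = 2] (mod (2 * r))"
      unfolding divisor_sigma_double_prime[OF p] by (simp add: cong_def)
    also have "\<dots> \<longleftrightarrow> 2 * r dvd 2 * (2 ^ (k + 1) + 1)"
      by (simp only: cong_add_rcancel_0_nat cong_0_iff)
    also have "\<dots> \<longleftrightarrow> r dvd 2 ^ (k + 1) + 1"
      by (rule nat_mult_dvd_cancel1) simp
    finally show ?thesis .
  qed
  ultimately show ?thesis by (simp add: S_def)
qed

lemma three_dvd_power_two_plus_one_iff:
  "(3::nat) dvd 2 ^ n + 1 \<longleftrightarrow> odd n"
proof (induction n)
  case (Suc n)
  \<comment> \<open>Doubling swaps the residues 1 and 2 modulo 3, so each further factor 2 flips the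
    divisibility.\<close>
  have "(3::nat) dvd 2 * x + 1 \<longleftrightarrow> \<not> 3 dvd x + 1" if "\<not> 3 dvd x" for x
    using that by presburger
  moreover have "\<not> (3::nat) dvd 2 ^ n"
    using prime_dvd_power_nat[of 3 2 n] by (auto dest: dvd_imp_le)
  ultimately show ?case using Suc by simp
qed (auto dest: dvd_imp_le)

lemma fourteen_in_S_iff: "14 \<in> S k \<longleftrightarrow> even k"
proof -
  have "prime (7::nat)" by simp
  from double_prime_in_S_iff[OF this, of 3 k] show ?thesis
    using three_dvd_power_two_plus_one_iff[of "k + 1"] by simp
qed

text \<open>The order h of \<open>a\<close> divides 2t, since a^(2t) = 1, but not t, since a^t = -1
  differs from 1 when \<open>r > 2\<close>. So h = 2s and t is an odd multiple of s, which gives a^s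
  = a^t = -1.\<close>

lemma power_eq_neg_one_exponents:
  fixes a r t :: nat
  assumes r: "r > 2" and t: "r dvd a ^ t + 1"
  obtains s where "s > 0" "ord r a = 2 * s" "\<And>u. r dvd a ^ u + 1 \<longleftrightarrow> [u = s] (mod (2 * s))"
proof -
  define h where "h = ord r a"
  \<comment> \<open>Any known solution \<open>v\<close> stands in for -1: the condition on
    \<open>u\<close> becomes equality of two powers, which the order decides.\<close>
  have neg: "r dvd a ^ u + 1 \<longleftrightarrow> [a ^ u = a ^ v] (mod r)" if "r dvd a ^ v + 1" for u v
    using that cong_add_rcancel_nat[of "a ^ u" 1 "a ^ v" r] by (simp add: cong_def dvd_eq_mod_eq_0)
  have "t \<noteq> 0"
  proof
    assume "t = 0"
    with t r show False by (auto dest: dvd_imp_le)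
  qed
  have cop: "coprime r a"
  proof (rule coprimeI)
    fix c assume "c dvd r" "c dvd a"
    then have "c dvd a ^ t + 1" "c dvd a ^ t"
      using t \<open>t \<noteq> 0\<close> by (auto intro: dvd_trans dvd_power)
    then show "is_unit c" using dvd_add_right_iff by blast
  qed
  have "[a ^ (2 * t) = 1] (mod r)"
  proof -
    \<comment> \<open>Squaring -1 without subtraction: \<open>a ^ t * (a ^ t + 1)\<close> and
      \<open>a ^ t + 1\<close> are both 0 modulo \<open>r\<close>, and cancelling
      \<open>a ^ t + 1\<close> leaves a^(2t) = 1.\<close>
    have "a ^ (2 * t) + (a ^ t + 1) = a ^ t * (a ^ t + 1) + 1"
      by (simp add: algebra_simps power2_eq_square power_mult)
    also have "[\<dots> = (a ^ t + 1) + 1] (mod r)"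
    proof (intro cong_add cong_refl)
      have "r dvd a ^ t * (a ^ t + 1)" using t by (rule dvd_mult)
      with t show "[a ^ t * (a ^ t + 1) = a ^ t + 1] (mod r)"
        unfolding cong_def dvd_eq_mod_eq_0 by (rule trans[OF _ sym, rotated])
    qed
    finally show ?thesis
      by (metis add.commute cong_add_rcancel_nat)
  qed
  then have h2t: "h dvd 2 * t" by (simp only: h_def ord_divides)
  have hnt: "\<not> h dvd t"
  proof
    assume "h dvd t"
    then have "[a ^ t = 1] (mod r)" by (simp only: h_def ord_divides)
    then have "[a ^ t + 1 = 1 + 1] (mod r)" by (rule cong_add) simp
    then have "r dvd 2" using t by (simp add: cong_def dvd_eq_mod_eq_0 numeral_2_eq_2)
    with r show False by (auto dest: dvd_imp_le)
  qed
  have "even h"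
  proof (rule ccontr)
    assume "odd h"
    then have "coprime h 2" by simp
    with h2t hnt show False by (simp add: coprime_dvd_mult_right_iff)
  qed
  then obtain s where s: "h = 2 * s" by blast
  with h2t obtain j where j: "t = s * j" by auto
  have "odd j"
  proof
    assume "even j"
    then have "h dvd t" unfolding s j by auto
    with hnt show False ..
  qed
  then obtain i where i: "j = 2 * i + 1" by (elim oddE)
  \<comment> \<open>Here t = s(2i + 1) = s + ih.\<close>
  have "[t = s] (mod h)"
    unfolding s j i by (simp add: cong_def algebra_simps)
  then have st: "[a ^ s = a ^ t] (mod r)"
    using order_divides_expdiff[OF cop] by (simp add: h_def cong_sym)
  then have rs: "r dvd a ^ s + 1" using neg[OF t] by blast
  show thesis
  proof
    show "s > 0" using \<open>t \<noteq> 0\<close> j by (cases s) auto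
    show "ord r a = 2 * s" using s h_def by simp
    show "r dvd a ^ u + 1 \<longleftrightarrow> [u = s] (mod (2 * s))" for u
      using neg[OF rs] order_divides_expdiff[OF cop] s h_def by simp
  qed
qed

lemma even_neg_one_exponents:
  assumes "r > 2" "even_neg_one_exponent r t"
  defines "t\<^sub>0 \<equiv> LEAST t. even_neg_one_exponent r t"
  shows "even t\<^sub>0" "t\<^sub>0 > 0" "ord r 2 = 2 * t\<^sub>0"
    "r dvd 2 ^ u + 1 \<longleftrightarrow> [u = t\<^sub>0] (mod (2 * t\<^sub>0))"
proof -
  have t: "even t" "r dvd 2 ^ t + 1"
    using assms(2) by (simp_all add: even_neg_one_exponent_iff_dvd)
  obtain s where s: "s > 0" "ord r 2 = 2 * s"
      "\<And>u. r dvd 2 ^ u + 1 \<longleftrightarrow> [u = s] (mod (2 * s))"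
    using power_eq_neg_one_exponents[OF assms(1) t(2)] by blast
  \<comment> \<open>The modulus \<open>2 * s\<close> is even, so all solutions have the parity of
    \<open>s\<close>; the even solution \<open>t\<close> forces \<open>s\<close> to be even.\<close>
  have "[t = s] (mod 2)" using s(3) t(2) cong_dvd_modulus_nat dvd_triv_left by blast
  then have "even s" using t(1) by (simp add: cong_dvd_iff)
  have "t\<^sub>0 = s"
    unfolding t\<^sub>0_def
  proof (rule Least_equality)
    show "even_neg_one_exponent r s"
      using \<open>even s\<close> s by (auto simp: even_neg_one_exponent_iff_dvd)
    fix u assume "even_neg_one_exponent r u"
    then have "[u = s] (mod (2 * s))" using s(3) by (simp add: even_neg_one_exponent_iff_dvd)
    \<comment> \<open>If \<open>u < s\<close>, both would be reduced residues modulo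
      \<open>2 * s\<close>, hence equal.\<close>
    then show "s \<le> u" using s(1) by (cases "u < s") (auto simp: cong_def)
  qed
  then show "even t\<^sub>0" "t\<^sub>0 > 0" "ord r 2 = 2 * t\<^sub>0"
    "r dvd 2 ^ u + 1 \<longleftrightarrow> [u = t\<^sub>0] (mod (2 * t\<^sub>0))"
    using s \<open>even s\<close> by auto
qed

text \<open>With order 4q, the witness is 2q: the prime \<open>r\<close> divides one factor of
  2^(4q) - 1 = (2^(2q) + 1)(2^(2q) - 1), and the second is excluded because the order does not
  divide 2q.\<close>

lemma prime_four_dvd_ord_imp_even_neg_one_exponent:
  assumes "prime r" "odd r" "4 dvd ord r 2"
  shows "\<exists>t. even_neg_one_exponent r t"
proof -
  obtain q where q: "ord r 2 = 4 * q" using assms(3) by blast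
  have "coprime r 2" using assms(2) by simp
  \<comment> \<open>\<open>ord\<close> takes the value 0 exactly when the arguments are not coprime,
    so oddness of \<open>r\<close> rules out \<open>q = 0\<close>.\<close>
  then have "q > 0" using q ord_eq_0[of r 2] by (cases q) auto
  have "[2 ^ (4 * q) = 1] (mod r)" using ord[of 2 r] q by simp
  then have "r dvd 2 ^ (4 * q) - 1"
    by (metis cong_altdef_nat one_le_power one_le_numeral)
  moreover have "(2::nat) ^ (4 * q) - 1 = (2 ^ (2 * q) + 1) * (2 ^ (2 * q) - 1)"
    by (simp add: algebra_simps flip: power_add)
  ultimately have "r dvd 2 ^ (2 * q) + 1 \<or> r dvd 2 ^ (2 * q) - 1"
    using assms(1) prime_dvd_mult_iff by metis
  moreover have "\<not> r dvd 2 ^ (2 * q) - 1"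
  proof
    assume "r dvd 2 ^ (2 * q) - 1"
    then have "[2 ^ (2 * q) = 1] (mod r)"
      by (metis cong_altdef_nat one_le_power one_le_numeral)
    then have "4 * q dvd 2 * q" using q ord_divides by metis
    with \<open>q > 0\<close> show False by (auto dest: dvd_imp_le)
  qed
  ultimately have "even_neg_one_exponent r (2 * q)"
    using \<open>q > 0\<close> by (simp add: even_neg_one_exponent_iff_dvd)
  then show ?thesis ..
qed

theorem theorem4p1:
  fixes p r m :: nat
  assumes "prime p" and "odd p" and "p \<ge> 5" and "[p = 3] (mod 4)"
    and "p - 1 = 2 * r" and "r > 1" and "odd r"
    and "m = ord r 2"
  shows "((\<exists>k\<ge>1. 2 * p \<in> S k \<and> 14 \<in> S (k - 1) \<and> 14 \<in> S (k + 1))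
            \<longleftrightarrow> (\<exists>t. even_neg_one_exponent r t))
       \<and> ((\<exists>t. even_neg_one_exponent r t) \<longrightarrow>
            (let t\<^sub>0 = (LEAST t. even_neg_one_exponent r t) in
               m = 2 * t\<^sub>0 \<and>
               (LEAST k. r dvd 2 ^ (k + 1) + 1) = t\<^sub>0 - 1 \<and>
               {k. r dvd 2 ^ (k + 1) + 1} = {k. [k = t\<^sub>0 - 1] (mod (2 * t\<^sub>0))}))
       \<and> (prime r \<longrightarrow> ((\<exists>t. even_neg_one_exponent r t) \<longleftrightarrow> 4 dvd ord r 2))"
proof (intro conjI impI)
  have r2: "r > 2" using assms(6,7) by (cases "r = 2") auto
  note S_iff = double_prime_in_S_iff[OF assms(1,2,5)]
  show "(\<exists>k\<ge>1. 2 * p \<in> S k \<and> 14 \<in> S (k - 1) \<and> 14 \<in> S (k + 1))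
            \<longleftrightarrow> (\<exists>t. even_neg_one_exponent r t)" (is "?L \<longleftrightarrow> ?R")
  proof
    assume ?L
    then obtain k where "k \<ge> 1" "r dvd 2 ^ (k + 1) + 1" "even (k + 1)"
      unfolding S_iff fourteen_in_S_iff by blast
    then have "even_neg_one_exponent r (k + 1)"
      unfolding even_neg_one_exponent_iff_dvd by simp
    then show ?R ..
  next
    assume ?R
    then obtain t where t: "even t" "t \<ge> 2" "r dvd 2 ^ t + 1"
      unfolding even_neg_one_exponent_iff_dvd by blast
    \<comment> \<open>The witness is k = t - 1; the bound \<open>t \<ge> 2\<close> keeps both
      truncated subtractions exact.\<close>
    then have "t - 1 \<ge> 1" "t - 1 + 1 = t" "even (t - 1 - 1)" by auto
    then show ?L
      unfolding S_iff fourteen_in_S_iff using t by (intro exI[of _ "t - 1"]) simp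
  qed
  show "let t\<^sub>0 = (LEAST t. even_neg_one_exponent r t) in
               m = 2 * t\<^sub>0 \<and>
               (LEAST k. r dvd 2 ^ (k + 1) + 1) = t\<^sub>0 - 1 \<and>
               {k. r dvd 2 ^ (k + 1) + 1} = {k. [k = t\<^sub>0 - 1] (mod (2 * t\<^sub>0))}"
    if ex: "\<exists>t. even_neg_one_exponent r t"
  proof -
    define t\<^sub>0 where "t\<^sub>0 = (LEAST t. even_neg_one_exponent r t)"
    obtain t where "even_neg_one_exponent r t" using ex by blast
    note t0 = even_neg_one_exponents[OF r2 this, folded t\<^sub>0_def]
    \<comment> \<open>Shifting the exponent by one is legitimate because t0 > 0, so the truncated
      predecessor of t0 plus 1 is t0 again.\<close>
    have iff: "r dvd 2 ^ (k + 1) + 1 \<longleftrightarrow> [k = t\<^sub>0 - 1] (mod (2 * t\<^sub>0))" for k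
      using t0(4)[of "k + 1"] t0(2) cong_add_rcancel_nat[of k 1 "t\<^sub>0 - 1" "2 * t\<^sub>0"] by simp
    have "(LEAST k. r dvd 2 ^ (k + 1) + 1) = t\<^sub>0 - 1"
      unfolding iff
    proof (rule Least_equality)
      fix k assume "[k = t\<^sub>0 - 1] (mod (2 * t\<^sub>0))"
      then show "t\<^sub>0 - 1 \<le> k"
        using t0(2) by (cases "k < t\<^sub>0 - 1") (auto simp: cong_def)
    qed simp
    then show ?thesis
      unfolding t\<^sub>0_def[symmetric] Let_def using t0(3) assms(8) iff by simp
  qed
  show "(\<exists>t. even_neg_one_exponent r t) \<longleftrightarrow> 4 dvd ord r 2" if "prime r"
  proof
    assume "\<exists>t. even_neg_one_exponent r t"
    then obtain t where t: "even_neg_one_exponent r t" ..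
    \<comment> \<open>The order is twice the least even solution. Primality of \<open>r\<close>
      matters only for the converse.\<close>
    show "4 dvd ord r 2"
      using even_neg_one_exponents(1,3)[OF r2 t] by (auto elim!: evenE)
  qed (use prime_four_dvd_ord_imp_even_neg_one_exponent that assms(7) in blast)
qed

end
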